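(* Let $L, n, K$ be integers with $2K \le n$, $L + 1 \le K$, and $L \ge 12 \ln(4n)$. Suppose $\mathcal{A}$ is an adversarially robust coloring algorithm for insert-only graph streams on the vertex set $[n]$ which works as long as the input graph has maximum degree at most $L$, and which maintains a coloring using at most $K$ colors such that, against any adaptive adversary, with probability at least $1/4$ all the colorings it reports are proper. Then $\mathcal{A}$ uses at least $C$ bits of space, where \[ C \ge \frac{1}{40 \ln 2}\cdot \frac{n L^2}{K} - 3. \]
   Context: An insert-only graph stream on vertex set $[n]$ is a sequence of edges (each edge appearing at most once), describing the graph formed by all edges inserted so far. A randomized streaming algorithm with $s$ bits of space and random string $R$ consists of an initial state (a function of $R$), a state-update function taking the current $s$-bit state, the next stream token and $R$ to a new $s$-bit state, and a query function taking the current state and $R$ to an output (here: an assignment of colors to the $n$ vertices). Adaptive adversary model: an adversary generates the stream token by token, where the $i$-th token is an arbitrary deterministic function of the outputs the algorithm gave to queries after each of the previous tokens (the adversary may query the algorithm after every token). A $K$-coloring output is proper if it uses at most $K$ colors and no edge of the current graph has both endpoints of the same color. The algorithm's space is the number of bits $s$ of its state. *)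

theory Defs
  imports "HOL-Probability.Probability"
begin

type_synonym edge = "nat set"

type_synonym coloring = "nat \<Rightarrow> nat"

definition edges_on :: "nat \<Rightarrow> edge set" where
  "edges_on n = {e. e \<subseteq> {1..n} \<and> card e = 2}"

text \<open>Colors are natural numbers. A coloring is \<^const>\<open>undefined\<close> outside the vertex set, so
  that it carries no information besides the colors of the vertices and the set of colorings is
  countable.\<close>

definition colorings :: "nat \<Rightarrow> coloring set" where
  "colorings n = {1..n} \<rightarrow>\<^sub>E UNIV"

definition valid_stream :: "nat \<Rightarrow> nat \<Rightarrow> edge list \<Rightarrow> bool" where
  "valid_stream n L es \<longleftrightarrow>
     distinct es \<and> set es \<subseteq> edges_on n \<and> (\<forall>v\<in>{1..n}. card {e \<in> set es. v \<in> e} \<le> L)"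

definition proper_coloring :: "nat \<Rightarrow> nat \<Rightarrow> edge set \<Rightarrow> coloring \<Rightarrow> bool" where
  "proper_coloring n K E c \<longleftrightarrow>
     card (c ` {1..n}) \<le> K \<and> (\<forall>u\<in>{1..n}. \<forall>v\<in>{1..n}. {u, v} \<in> E \<and> u \<noteq> v \<longrightarrow> c u \<noteq> c v)"

definition states :: "nat \<Rightarrow> bool list set" where
  "states s = {x. length x = s}"

record 'r stream_alg =
  init :: "'r \<Rightarrow> bool list"
  update :: "'r \<Rightarrow> bool list \<Rightarrow> edge \<Rightarrow> bool list"
  query :: "'r \<Rightarrow> bool list \<Rightarrow> coloring"

text \<open>The random string is drawn from an arbitrary probability space \<open>M\<close>. Each membership below
  states both that the values lie in the given countable set and that they are random variables.\<close>

definition streaming_algorithm :: "'r measure \<Rightarrow> nat \<Rightarrow> nat \<Rightarrow> 'r stream_alg \<Rightarrow> bool" where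
  "streaming_algorithm M n s A \<longleftrightarrow>
     prob_space M \<and>
     init A \<in> M \<rightarrow>\<^sub>M count_space (states s) \<and>
     (\<forall>x\<in>states s. \<forall>e\<in>edges_on n. (\<lambda>r. update A r x e) \<in> M \<rightarrow>\<^sub>M count_space (states s)) \<and>
     (\<forall>x\<in>states s. (\<lambda>r. query A r x) \<in> M \<rightarrow>\<^sub>M count_space (colorings n))"

text \<open>An adversary maps the list of the outputs seen so far, oldest first, to its next token;
  \<^const>\<open>None\<close> ends the stream.\<close>

type_synonym adversary = "coloring list \<Rightarrow> edge option"

definition adv_stream :: "adversary \<Rightarrow> coloring list \<Rightarrow> edge list" where
  "adv_stream adv cs = map (\<lambda>i. the (adv (take i cs))) [0..<length cs]"

text \<open>The stream has to meet the promise (simple graph, maximum degree at most \<open>L\<close>) whatever the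
  algorithm answers; an adversary can stop after answers for which it cannot keep the promise.\<close>

definition valid_adversary :: "nat \<Rightarrow> nat \<Rightarrow> adversary \<Rightarrow> bool" where
  "valid_adversary n L adv \<longleftrightarrow>
     (\<forall>cs. set cs \<subseteq> colorings n \<and> (\<forall>i<length cs. adv (take i cs) \<noteq> None) \<longrightarrow>
        valid_stream n L (adv_stream adv cs))"

text \<open>State, stream and list of outputs after (up to) \<open>i\<close> tokens, with a query after each token.\<close>

primrec interaction ::
  "'r stream_alg \<Rightarrow> adversary \<Rightarrow> 'r \<Rightarrow> nat \<Rightarrow> bool list \<times> edge list \<times> coloring list" where
  "interaction A adv r 0 = (init A r, [], [])"
| "interaction A adv r (Suc i) =
     (case interaction A adv r i of (x, es, cs) \<Rightarrow>
        (case adv cs of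
           None \<Rightarrow> (x, es, cs)
         | Some e \<Rightarrow>
             (let x' = update A r x e in (x', es @ [e], cs @ [query A r x']))))"

definition all_proper ::
  "nat \<Rightarrow> nat \<Rightarrow> 'r stream_alg \<Rightarrow> adversary \<Rightarrow> 'r \<Rightarrow> bool" where
  "all_proper n K A adv r \<longleftrightarrow>
     (\<forall>i. case interaction A adv r i of (x, es, cs) \<Rightarrow>
        \<forall>j<length cs. proper_coloring n K (set (take (Suc j) es)) (cs ! j))"

definition robust_coloring ::
  "'r measure \<Rightarrow> nat \<Rightarrow> nat \<Rightarrow> nat \<Rightarrow> real \<Rightarrow> 'r stream_alg \<Rightarrow> bool" where
  "robust_coloring M n L K p A \<longleftrightarrow>
     (\<forall>adv. valid_adversary n L adv \<longrightarrow> measure M {r \<in> space M. all_proper n K A adv r} \<ge> p)"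

end

theory Submission
  imports Defs "HOL-Combinatorics.Permutations"
begin

text \<open>
  Cut \<open>[n]\<close> into \<open>k = \<lceil>n / 3K\<rceil>\<close> blocks of \<open>N\<close> vertices, so that \<open>N / K\<close> lies between about \<open>3/2\<close> and
  \<open>3\<close>. The adversary first inserts a random graph: in every block, the edges \<open>{v, \<sigma> v}\<close> of
  \<open>q = L div 4\<close> independent uniform permutations, which have maximum degree \<open>2 q\<close>. From then on it
  greedily inserts pairs that lie in one block, have the same color in the last coloring and whose
  endpoints have received fewer than \<open>d = L - 2 q\<close> greedy edges. Proper colorings only reveal pairs
  that are not yet edges, and the greedy phase can only get stuck when at most \<open>K\<close> vertices of each
  block are unsaturated; so its edges \<open>F\<close> have degree sum at least \<open>d (N - K)\<close> in each block.

  For a fixed random string, \<open>F\<close> is a function of the state after the first phase, hence takes at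
  most \<open>2 ^ s\<close> values, and \<open>F\<close> is disjoint from the random graph. By the Bregman-Minc bound on
  permanents, a random permutation of a block avoids \<open>F\<close> with probability at most about
  \<open>exp (- d (N - K) / N)\<close>, and the union bound over the states gives
  \<open>1/4 \<le> 2 ^ s exp (- k q d (N - K) / N)\<close> up to a factor \<open>24/25\<close> in the exponent.
\<close>

section \<open>The Bregman-Minc inequality\<close>

definition matchings :: "'a set \<Rightarrow> ('a \<Rightarrow> 'b set) \<Rightarrow> ('a \<Rightarrow> 'b) set" where
  "matchings R H = {\<sigma> \<in> Pi\<^sub>E R H. inj_on \<sigma> R}"

definition minor_matchings :: "'a set \<Rightarrow> ('a \<Rightarrow> 'b set) \<Rightarrow> 'a \<Rightarrow> 'b \<Rightarrow> ('a \<Rightarrow> 'b) set" where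
  "minor_matchings R H i k = matchings (R - {i}) (\<lambda>j. H j - {k})"

definition ln_fact_mean :: "nat \<Rightarrow> real" where
  "ln_fact_mean r = ln (fact r) / real r"

lemma finite_matchings:
  assumes "finite R" "\<And>i. i \<in> R \<Longrightarrow> finite (H i)"
  shows "finite (matchings R H)"
  unfolding matchings_def using assms by (auto intro: finite_subset[OF _ finite_PiE])

lemma matchings_apply: "\<sigma> \<in> matchings R H \<Longrightarrow> i \<in> R \<Longrightarrow> \<sigma> i \<in> H i"
  by (auto simp: matchings_def)

lemma bij_betw_matching:
  assumes "\<sigma> \<in> matchings R H" "finite C" "card R = card C" "\<And>i. i \<in> R \<Longrightarrow> H i \<subseteq> C"
  shows "bij_betw \<sigma> R C"
proof -
  have inj: "inj_on \<sigma> R" using assms(1) by (simp add: matchings_def)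
  have "\<sigma> ` R \<subseteq> C" using assms(4) matchings_apply[OF assms(1)] by blast
  then have "\<sigma> ` R = C" using assms(2,3) card_image[OF inj] by (intro card_subset_eq) auto
  with inj show ?thesis by (rule bij_betw_imageI)
qed

lemma card_matchings_fixed:
  assumes "i \<in> R" "k \<in> H i"
  shows "card {\<sigma> \<in> matchings R H. \<sigma> i = k} = card (minor_matchings R H i k)"
    (is "card ?A = _")
  unfolding minor_matchings_def
proof (rule bij_betw_same_card, rule bij_betw_byWitness)
  let ?M = "matchings (R - {i}) (\<lambda>j. H j - {k})"
  let ?restrict = "\<lambda>\<sigma>. restrict \<sigma> (R - {i})" and ?extend = "\<lambda>\<tau>. \<tau>(i := k)"
  show "\<forall>\<sigma>\<in>?A. ?extend (?restrict \<sigma>) = \<sigma>" "\<forall>\<tau>\<in>?M. ?restrict (?extend \<tau>) = \<tau>"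
    using assms by (auto simp: matchings_def PiE_def extensional_def fun_eq_iff)
  show "?restrict ` ?A \<subseteq> ?M"
    using assms by (auto simp: matchings_def PiE_def Pi_def inj_on_def)
  show "?extend ` ?M \<subseteq> ?A"
  proof (rule image_subsetI)
    fix \<tau> assume "\<tau> \<in> ?M"
    then have \<tau>: "\<tau> \<in> Pi\<^sub>E (R - {i}) (\<lambda>j. H j - {k})" "inj_on \<tau> (R - {i})"
      by (auto simp: matchings_def)
    then have "\<tau>(i := k) \<in> Pi\<^sub>E R H" using assms by (auto simp: PiE_def extensional_def)
    moreover have "inj_on (\<tau>(i := k)) (insert i (R - {i}))"
      unfolding inj_on_insert using \<tau> by (auto simp: inj_on_def)
    ultimately show "\<tau>(i := k) \<in> ?A" using assms by (simp add: matchings_def insert_absorb)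
  qed
qed

lemma minor_matchings_nonempty:
  assumes "\<sigma> \<in> matchings R H" "i \<in> R"
  shows "minor_matchings R H i (\<sigma> i) \<noteq> {}"
proof -
  have "restrict \<sigma> (R - {i}) \<in> minor_matchings R H i (\<sigma> i)"
    using assms by (auto simp: minor_matchings_def matchings_def inj_on_def)
  then show ?thesis by blast
qed

lemma sum_inverse_card_fibre:
  assumes "finite S"
  shows "(\<Sum>x\<in>S. 1 / real (card {y \<in> S. f y = f x})) = real (card (f ` S))"
proof -
  have "(\<Sum>x\<in>S. 1 / real (card {y \<in> S. f y = f x}))
      = (\<Sum>z\<in>f ` S. \<Sum>x | x \<in> S \<and> f x = z. 1 / real (card {y \<in> S. f y = f x}))"
    by (rule sum.image_gen[OF assms])
  also have "\<dots> = (\<Sum>z\<in>f ` S. 1)"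
  proof (rule sum.cong)
    fix z assume "z \<in> f ` S"
    then have "card {y \<in> S. f y = z} > 0" using assms by (auto simp: card_gt_0_iff)
    then show "(\<Sum>x | x \<in> S \<and> f x = z. 1 / real (card {y \<in> S. f y = f x})) = 1" by simp
  qed simp
  finally show ?thesis by simp
qed

text \<open>Up to a factor \<open>card S\<close>, this bounds the entropy of \<open>f x\<close>, for a uniform \<open>x \<in> S\<close>, by
  \<open>ln (card T)\<close>.\<close>

lemma card_mult_ln_card_le_fibres:
  assumes "finite S" "finite T" "f ` S \<subseteq> T"
  shows "real (card S) * ln (card S) \<le> (\<Sum>x\<in>S. ln (card T) + ln (card {y \<in> S. f y = f x}))"
proof (cases "S = {}")
  case False
  define fibre where "fibre x = real (card {y \<in> S. f y = f x})" for x
  have fibre: "fibre x > 0" if "x \<in> S" for x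
    using assms(1) that by (auto simp: fibre_def card_gt_0_iff)
  have card_S: "real (card S) > 0" and card_T: "real (card T) > 0"
    using assms False by (auto simp: card_gt_0_iff)
  have "ln (card S) - (ln (card T) + ln (fibre x)) \<le> card S / card T * (1 / fibre x) - 1"
    if "x \<in> S" for x
  proof -
    have "ln (card S) - (ln (card T) + ln (fibre x)) = ln (card S / (card T * fibre x))"
      using card_S card_T fibre[OF that] by (simp add: ln_div ln_mult)
    also have "\<dots> \<le> card S / (card T * fibre x) - 1"
      using card_S card_T fibre[OF that] by (intro ln_le_minus_one) auto
    finally show ?thesis by simp
  qed
  then have "(\<Sum>x\<in>S. ln (card S) - (ln (card T) + ln (fibre x)))
      \<le> (\<Sum>x\<in>S. card S / card T * (1 / fibre x) - 1)"
    by (rule sum_mono)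
  also have "\<dots> = card S / card T * (\<Sum>x\<in>S. 1 / fibre x) - card S"
    by (simp add: sum_subtractf sum_distrib_left)
  also have "\<dots> = card S / card T * card (f ` S) - card S"
    unfolding fibre_def sum_inverse_card_fibre[OF assms(1)] ..
  also have "\<dots> \<le> card S / card T * card T - card S"
    using card_mono[OF assms(2,3)] by (intro diff_right_mono mult_left_mono) auto
  also have "\<dots> = 0" using card_T by simp
  finally show ?thesis by (simp add: fibre_def sum_subtractf)
qed simp

lemma card_mult_ln_card_matchings_le:
  assumes "finite R" "\<And>j. j \<in> R \<Longrightarrow> finite (H j)" "i \<in> R"
  shows "card (matchings R H) * ln (card (matchings R H))
    \<le> (\<Sum>\<sigma>\<in>matchings R H. ln (card (H i)) + ln (card (minor_matchings R H i (\<sigma> i))))"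
proof -
  have "card {\<tau> \<in> matchings R H. \<tau> i = \<sigma> i} = card (minor_matchings R H i (\<sigma> i))"
    if "\<sigma> \<in> matchings R H" for \<sigma>
    using assms(3) matchings_apply[OF that assms(3)] by (rule card_matchings_fixed)
  then show ?thesis
    using card_mult_ln_card_le_fibres[of "matchings R H" "H i" "\<lambda>\<sigma>. \<sigma> i"] assms
    by (simp add: finite_matchings matchings_apply image_subset_iff)
qed

lemma ln_card_matchings_le:
  fixes b :: real
  assumes "finite R" "R \<noteq> {}" "\<And>j. j \<in> R \<Longrightarrow> finite (H j)" "matchings R H \<noteq> {}"
    and "\<And>\<sigma>. \<sigma> \<in> matchings R H \<Longrightarrow>
      (\<Sum>i\<in>R. ln (card (H i)) + ln (card (minor_matchings R H i (\<sigma> i)))) \<le> card R * b"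
  shows "ln (card (matchings R H)) \<le> b"
proof -
  let ?S = "matchings R H"
  have "card R * (card ?S * ln (card ?S))
      \<le> (\<Sum>i\<in>R. \<Sum>\<sigma>\<in>?S. ln (card (H i)) + ln (card (minor_matchings R H i (\<sigma> i))))"
    using assms(1,3) by (intro sum_bounded_below card_mult_ln_card_matchings_le)
  also have "\<dots> = (\<Sum>\<sigma>\<in>?S. \<Sum>i\<in>R. ln (card (H i)) + ln (card (minor_matchings R H i (\<sigma> i))))"
    by (rule sum.swap)
  also have "\<dots> \<le> card ?S * (card R * b)"
    using assms(5) by (rule sum_bounded_above)
  finally have "card R * (card ?S * ln (card ?S)) \<le> card R * (card ?S * b)"
    by (simp add: mult.left_commute)
  moreover have "real (card R) > 0" "real (card ?S) > 0"
    using assms(1-4) by (auto simp: card_gt_0_iff finite_matchings)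
  ultimately show ?thesis by simp
qed

lemma ln_fact_mean_pred:
  assumes "r > 0"
  shows "ln r + (real r - 1) * ln_fact_mean (r - 1) = real r * ln_fact_mean r"
proof (cases "r = 1")
  case False
  then obtain m where "r = Suc m" "m > 0" using assms by (cases r) auto
  then show ?thesis by (simp add: ln_fact_mean_def ln_mult)
qed (simp add: ln_fact_mean_def)

lemma sum_ln_fact_mean_card_delete:
  assumes "finite C" "D \<subseteq> C" "k \<in> D"
  shows "ln (card D) + (\<Sum>c\<in>C - {k}. ln_fact_mean (card (D - {c}))) = card C * ln_fact_mean (card D)"
proof -
  have D: "finite D" "card D > 0" "card D \<le> card C"
    using assms by (auto simp: card_gt_0_iff intro: finite_subset card_mono)
  have "(\<Sum>c\<in>C - {k}. ln_fact_mean (card (D - {c})))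
      = (\<Sum>c\<in>C - D. ln_fact_mean (card (D - {c}))) + (\<Sum>c\<in>D - {k}. ln_fact_mean (card (D - {c})))"
    using assms D(1) by (subst sum.union_disjoint[symmetric]) (auto intro!: sum.cong)
  also have "(\<Sum>c\<in>C - D. ln_fact_mean (card (D - {c})))
      = real (card (C - D)) * ln_fact_mean (card D)"
    by simp
  also have "real (card (C - D)) = real (card C) - real (card D)"
    using assms D by (simp add: card_Diff_subset of_nat_diff)
  also have "(\<Sum>c\<in>D - {k}. ln_fact_mean (card (D - {c})))
      = (real (card D) - 1) * ln_fact_mean (card D - 1)"
    using assms D by (simp add: card_Diff_singleton of_nat_diff)
  finally show ?thesis using ln_fact_mean_pred[OF D(2)] by (simp add: algebra_simps)
qed

lemma sum_ln_fact_mean_minors: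
  assumes "finite C" "bij_betw \<sigma> R C" "\<And>j. j \<in> R \<Longrightarrow> \<sigma> j \<in> H j" "\<And>j. j \<in> R \<Longrightarrow> H j \<subseteq> C"
  shows "(\<Sum>i\<in>R. ln (card (H i)) + (\<Sum>j\<in>R - {i}. ln_fact_mean (card (H j - {\<sigma> i}))))
    = card R * (\<Sum>j\<in>R. ln_fact_mean (card (H j)))"
proof -
  have fin: "finite R" using assms(1,2) bij_betw_finite by blast
  have "(\<Sum>i\<in>R. \<Sum>j\<in>R - {i}. ln_fact_mean (card (H j - {\<sigma> i})))
      = (\<Sum>i\<in>R. \<Sum>j | j \<in> R \<and> i \<noteq> j. ln_fact_mean (card (H j - {\<sigma> i})))"
    by (intro sum.cong) auto
  also have "\<dots> = (\<Sum>j\<in>R. \<Sum>i | i \<in> R \<and> i \<noteq> j. ln_fact_mean (card (H j - {\<sigma> i})))"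
    using fin by (rule sum.swap_restrict) (rule fin)
  also have "\<dots> = (\<Sum>j\<in>R. \<Sum>i\<in>R - {j}. ln_fact_mean (card (H j - {\<sigma> i})))"
    by (intro sum.cong) auto
  also have "\<dots> = (\<Sum>j\<in>R. \<Sum>c\<in>C - {\<sigma> j}. ln_fact_mean (card (H j - {c})))"
    using assms(2) by (intro sum.cong sum.reindex_bij_betw bij_betw_DiffI) (auto simp: bij_betw_def)
  finally have "(\<Sum>i\<in>R. ln (card (H i)) + (\<Sum>j\<in>R - {i}. ln_fact_mean (card (H j - {\<sigma> i}))))
      = (\<Sum>j\<in>R. ln (card (H j)) + (\<Sum>c\<in>C - {\<sigma> j}. ln_fact_mean (card (H j - {c}))))"
    by (simp add: sum.distrib)
  also have "\<dots> = (\<Sum>j\<in>R. card C * ln_fact_mean (card (H j)))"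
    using assms by (intro sum.cong sum_ln_fact_mean_card_delete) auto
  finally show ?thesis using bij_betw_same_card[OF assms(2)] by (simp add: sum_distrib_left)
qed

text \<open>Schrijver's proof, in logarithmic form: the entropy bound is applied to the image of every
  single row, and the induction hypotheses for the minors are summed over all rows and matchings.\<close>

theorem bregman_minc:
  assumes "finite C" "finite R" "card R = card C" "\<And>j. j \<in> R \<Longrightarrow> H j \<subseteq> C" "matchings R H \<noteq> {}"
  shows "ln (card (matchings R H)) \<le> (\<Sum>j\<in>R. ln_fact_mean (card (H j)))"
  using assms
proof (induction "card R" arbitrary: R C H)
  case 0
  then have "R = {}" by simp
  then show ?case by (simp add: matchings_def)
next
  case (Suc m)
  show ?case
  proof (rule ln_card_matchings_le)
    fix \<sigma> assume \<sigma>: "\<sigma> \<in> matchings R H"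
    have bij: "bij_betw \<sigma> R C" using \<sigma> Suc.prems by (intro bij_betw_matching)
    have minor: "ln (card (minor_matchings R H i (\<sigma> i)))
        \<le> (\<Sum>j\<in>R - {i}. ln_fact_mean (card (H j - {\<sigma> i})))" if i: "i \<in> R" for i
    proof -
      have "\<sigma> i \<in> C" using bij_betwE[OF bij] i by blast
      then show ?thesis
        using Suc.prems Suc.hyps(2) i minor_matchings_nonempty[OF \<sigma> i]
        unfolding minor_matchings_def
        by (intro Suc.hyps(1)[of "R - {i}" "C - {\<sigma> i}"]) auto
    qed
    have "(\<Sum>i\<in>R. ln (card (H i)) + ln (card (minor_matchings R H i (\<sigma> i))))
        \<le> (\<Sum>i\<in>R. ln (card (H i)) + (\<Sum>j\<in>R - {i}. ln_fact_mean (card (H j - {\<sigma> i}))))"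
      using minor by (intro sum_mono) auto
    also have "\<dots> = card R * (\<Sum>j\<in>R. ln_fact_mean (card (H j)))"
      using matchings_apply[OF \<sigma>] Suc.prems by (intro sum_ln_fact_mean_minors[OF _ bij])
    finally show "(\<Sum>i\<in>R. ln (card (H i)) + ln (card (minor_matchings R H i (\<sigma> i))))
        \<le> card R * (\<Sum>j\<in>R. ln_fact_mean (card (H j)))" .
  qed (use Suc.prems Suc.hyps(2) finite_subset[OF Suc.prems(4) Suc.prems(1)] in auto)
qed

section \<open>Permutations that avoid a relation\<close>

lemma ln_fact_le_Stirling:
  assumes "r > 0"
  shows "ln (fact r) \<le> (real r + 1/2) * ln r - real r + 1"
  using assms
proof (induction r rule: nat_induct_non_zero)
  case (Suc r)
  have "2 / (2 * real r + 1) \<le> ln (real (Suc r)) - ln r"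
    using ln_inverse_approx_ge[of "real r" "real (Suc r)"] Suc.hyps by (simp add: add_ac)
  then have "(real r + 1/2) * (2 / (2 * real r + 1)) \<le> (real r + 1/2) * (ln (real (Suc r)) - ln r)"
    by (rule mult_left_mono) simp
  moreover have "(real r + 1/2) * (2 / (2 * real r + 1)) = 1" by (simp add: field_simps)
  moreover have "ln (fact (Suc r)) = ln (real (Suc r)) + ln (fact r)"
    by (simp add: ln_mult del: of_nat_Suc)
  ultimately show ?case using Suc.IH by (simp add: algebra_simps)
qed simp

definition row_gain :: "nat \<Rightarrow> real" where
  "row_gain m = 1 - ln m / (2 * (real m - 1))"

lemma row_gain_mono:
  assumes "2 \<le> m" "m \<le> r"
  shows "row_gain m \<le> row_gain r"
proof -
  have "(real m - 1) * (ln r - ln m) \<le> (real m - 1) * ((real r - real m) / real m)"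
    using assms by (intro mult_left_mono ln_diff_le) auto
  also have "\<dots> = (1 - 1 / real m) * (real r - real m)"
    using assms by (simp add: field_simps)
  also have "\<dots> \<le> ln m * (real r - real m)"
    using ln_le_minus_one[of "1 / real m"] assms by (intro mult_right_mono) (auto simp: ln_div)
  finally have "ln r / (2 * (real r - 1)) \<le> ln m / (2 * (real m - 1))"
    using assms by (simp add: field_simps)
  then show ?thesis by (simp add: row_gain_def)
qed

lemma row_gain_nonneg:
  assumes "2 \<le> m"
  shows "0 \<le> row_gain m"
  using ln_le_minus_one[of "real m"] assms by (simp add: row_gain_def field_simps)

lemma row_gain_le_ln_fact_mean_diff:
  assumes "r \<ge> 2"
  shows "row_gain r / r \<le> ln_fact_mean r - ln_fact_mean (r - 1)"
proof -
  have fact: "ln (fact r) = ln r + ln (fact (r - 1))"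
    using assms by (simp add: fact_reduce ln_mult)
  have "(real r - 1) * row_gain r = real r - 1 - ln r / 2"
    using assms by (simp add: row_gain_def field_simps)
  also have "\<dots> \<le> real r * ln r - ln (fact r)"
    using ln_fact_le_Stirling[of r] assms by (simp add: algebra_simps)
  also have "\<dots> = (real r - 1) * (r * (ln_fact_mean r - ln_fact_mean (r - 1)))"
    unfolding ln_fact_mean_def fact using assms by (simp add: of_nat_diff field_simps)
  finally have "row_gain r \<le> r * (ln_fact_mean r - ln_fact_mean (r - 1))"
    using assms by simp
  then show ?thesis using assms by (simp add: field_simps)
qed

lemma ln_fact_mean_minus_le:
  assumes "2 \<le> m" "f + m \<le> N"
  shows "ln_fact_mean (N - f) \<le> ln_fact_mean N - row_gain m * f / N"
  using assms(2)
proof (induction f)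
  case (Suc f)
  have "row_gain m / N \<le> row_gain (N - f) / (N - f)"
    using Suc.prems assms(1) row_gain_mono[of m "N - f"] row_gain_nonneg
    by (intro frac_le) auto
  also have "\<dots> \<le> ln_fact_mean (N - f) - ln_fact_mean (N - f - 1)"
    using Suc.prems assms(1) by (intro row_gain_le_ln_fact_mean_diff) auto
  finally have "row_gain m / N \<le> ln_fact_mean (N - f) - ln_fact_mean (N - Suc f)" by simp
  then show ?case using Suc by (simp add: algebra_simps add_divide_distrib)
qed simp

lemma card_permutes_le_card_matchings:
  assumes "finite B" "\<And>v. v \<in> B \<Longrightarrow> finite (H v)"
  shows "card {\<sigma>. \<sigma> permutes B \<and> (\<forall>v\<in>B. \<sigma> v \<in> H v)} \<le> card (matchings B H)"
    (is "card ?S \<le> _")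
proof (rule card_inj_on_le)
  show "inj_on (\<lambda>\<sigma>. restrict \<sigma> B) ?S"
  proof (intro inj_onI ext)
    fix \<sigma> \<tau> x assume eq: "\<sigma> \<in> ?S" "\<tau> \<in> ?S" "restrict \<sigma> B = restrict \<tau> B"
    show "\<sigma> x = \<tau> x"
      using eq by (cases "x \<in> B") (auto simp: permutes_not_in dest: fun_cong[of _ _ x])
  qed
  show "(\<lambda>\<sigma>. restrict \<sigma> B) ` ?S \<subseteq> matchings B H"
    by (auto simp: matchings_def inj_on_def dest: permutes_inj)
qed (use assms in \<open>rule finite_matchings\<close>)

lemma card_permutes_avoiding_le:
  assumes "finite B" "2 \<le> m" "\<And>v. v \<in> B \<Longrightarrow> A v \<subseteq> B" "\<And>v. v \<in> B \<Longrightarrow> card (A v) + m \<le> card B"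
  shows "real (card {\<sigma>. \<sigma> permutes B \<and> (\<forall>v\<in>B. \<sigma> v \<notin> A v)})
    \<le> fact (card B) * exp (- (row_gain m * (\<Sum>v\<in>B. card (A v)) / card B))"
    (is "real (card ?S) \<le> fact (card B) * exp (- ?gain)")
proof -
  let ?M = "matchings B (\<lambda>v. B - A v)"
  have fin: "finite ?M" using assms(1) by (intro finite_matchings) auto
  have "?S = {\<sigma>. \<sigma> permutes B \<and> (\<forall>v\<in>B. \<sigma> v \<in> B - A v)}"
    by (auto simp: permutes_in_image)
  then have "real (card ?S) \<le> card ?M"
    using card_permutes_le_card_matchings[of B "\<lambda>v. B - A v"] assms(1) by simp
  also have "\<dots> \<le> fact (card B) * exp (- ?gain)"
  proof (cases "?M = {}")
    case False
    have "ln (card ?M) \<le> (\<Sum>v\<in>B. ln_fact_mean (card (B - A v)))"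
      using assms(1) False by (intro bregman_minc[of B]) auto
    also have "\<dots> \<le> (\<Sum>v\<in>B. ln_fact_mean (card B) - row_gain m * card (A v) / card B)"
    proof (rule sum_mono)
      fix v assume v: "v \<in> B"
      have "card (B - A v) = card B - card (A v)"
        using assms(1) assms(3)[OF v] finite_subset by (intro card_Diff_subset) auto
      then show "ln_fact_mean (card (B - A v))
          \<le> ln_fact_mean (card B) - row_gain m * card (A v) / card B"
        using assms(2) assms(4)[OF v] by (simp add: ln_fact_mean_minus_le)
    qed
    also have "\<dots> = ln (fact (card B)) - ?gain"
      by (cases "card B = 0")
         (auto simp: sum_subtractf ln_fact_mean_def sum_distrib_left sum_divide_distrib)
    finally have "exp (ln (card ?M)) \<le> exp (ln (fact (card B)) - ?gain)" by simp
    moreover have "exp (ln (card ?M)) = card ?M" using False fin by (simp add: card_gt_0_iff)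
    ultimately show ?thesis by (simp add: exp_diff exp_minus field_simps)
  qed simp
  finally show ?thesis .
qed

section \<open>Random permutation graphs\<close>

definition vertex_degree :: "'a set set \<Rightarrow> 'a \<Rightarrow> nat" where
  "vertex_degree E v = card {e \<in> E. v \<in> e}"

lemma vertex_degree_empty [simp]: "vertex_degree {} v = 0"
  by (simp add: vertex_degree_def)

lemma vertex_degree_singleton [simp]: "vertex_degree {e} v = of_bool (v \<in> e)"
proof -
  have "{e' \<in> {e}. v \<in> e'} = (if v \<in> e then {e} else {})" by auto
  then show ?thesis by (simp add: vertex_degree_def)
qed

lemma vertex_degree_mono: "finite E' \<Longrightarrow> E \<subseteq> E' \<Longrightarrow> vertex_degree E v \<le> vertex_degree E' v"
  unfolding vertex_degree_def by (intro card_mono) auto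

lemma vertex_degree_Un_le: "vertex_degree (E \<union> E') v \<le> vertex_degree E v + vertex_degree E' v"
proof -
  have "{e \<in> E \<union> E'. v \<in> e} = {e \<in> E. v \<in> e} \<union> {e \<in> E'. v \<in> e}" by auto
  then show ?thesis by (simp add: vertex_degree_def card_Un_le)
qed

lemma card_neighbours:
  assumes "\<And>e. e \<in> E \<Longrightarrow> card e = 2"
  shows "card {u. {v, u} \<in> E} = vertex_degree E v"
  unfolding vertex_degree_def
proof (rule bij_betw_same_card, rule bij_betw_imageI)
  show "inj_on (\<lambda>u. {v, u}) {u. {v, u} \<in> E}" by (auto simp: inj_on_def doubleton_eq_iff)
  show "(\<lambda>u. {v, u}) ` {u. {v, u} \<in> E} = {e \<in> E. v \<in> e}"
  proof (intro equalityI subsetI)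
    fix e assume e: "e \<in> {e \<in> E. v \<in> e}"
    then obtain u where "e = {v, u}" using assms[of e] by (auto simp: card_2_iff)
    then show "e \<in> (\<lambda>u. {v, u}) ` {u. {v, u} \<in> E}" using e by auto
  qed auto
qed

definition edges_within :: "'a set set \<Rightarrow> 'a set set" where
  "edges_within \<B> = {e. card e = 2 \<and> (\<exists>B\<in>\<B>. e \<subseteq> B)}"

lemma card_PiE_times_const:
  assumes "finite I"
  shows "card (\<Pi>\<^sub>E (i, j)\<in>I \<times> {..<q}. P i) = (\<Prod>i\<in>I. card (P i)) ^ q"
proof -
  have "card (\<Pi>\<^sub>E (i, j)\<in>I \<times> {..<q}. P i) = (\<Prod>(i, j)\<in>I \<times> {..<q}. card (P i))"
    using assms by (subst card_PiE) (auto intro!: prod.cong)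
  also have "\<dots> = (\<Prod>i\<in>I. card (P i) ^ q)"
    by (subst prod.cartesian_product[symmetric]) simp
  finally show ?thesis by (simp add: prod_power_distrib)
qed

locale disjoint_blocks =
  fixes \<B> :: "'a set set"
  assumes finite_blocks: "finite \<B>"
    and finite_block: "B \<in> \<B> \<Longrightarrow> finite B"
    and disjoint: "disjoint \<B>"
begin

lemma block_unique: "B \<in> \<B> \<Longrightarrow> B' \<in> \<B> \<Longrightarrow> v \<in> B \<Longrightarrow> v \<in> B' \<Longrightarrow> B = B'"
  using disjointD[OF disjoint] by blast

lemma finite_edges_within: "finite (edges_within \<B>)"
  by (rule finite_subset[of _ "\<Union>B\<in>\<B>. Pow B"])
     (auto simp: edges_within_def finite_blocks finite_block)

lemma neighbours_subset_block:
  assumes "F \<subseteq> edges_within \<B>" "B \<in> \<B>" "v \<in> B"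
  shows "{u. {v, u} \<in> F} \<subseteq> B"
proof
  fix u assume "u \<in> {u. {v, u} \<in> F}"
  then obtain B' where "B' \<in> \<B>" "{v, u} \<subseteq> B'" using assms(1) by (auto simp: edges_within_def)
  then show "u \<in> B" using block_unique[of B' B v] assms(2,3) by auto
qed

definition perm_families :: "nat \<Rightarrow> ('a set \<times> nat \<Rightarrow> 'a \<Rightarrow> 'a) set" where
  "perm_families q = (\<Pi>\<^sub>E (B, j)\<in>\<B> \<times> {..<q}. {\<sigma>. \<sigma> permutes B})"

definition perm_graph :: "nat \<Rightarrow> ('a set \<times> nat \<Rightarrow> 'a \<Rightarrow> 'a) \<Rightarrow> 'a set set" where
  "perm_graph q \<omega> = {{v, \<omega> (B, j) v} | B j v. B \<in> \<B> \<and> j < q \<and> v \<in> B \<and> \<omega> (B, j) v \<noteq> v}"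

lemma perm_families_permutes:
  "\<omega> \<in> perm_families q \<Longrightarrow> B \<in> \<B> \<Longrightarrow> j < q \<Longrightarrow> \<omega> (B, j) permutes B"
  unfolding perm_families_def by (drule PiE_mem[of _ _ _ "(B, j)"]) auto

lemma finite_perm_families: "finite (perm_families q)"
  unfolding perm_families_def
  using finite_blocks by (intro finite_PiE) (auto simp: finite_block finite_permutations)

lemma card_perm_families: "card (perm_families q) = (\<Prod>B\<in>\<B>. fact (card B)) ^ q"
  unfolding perm_families_def card_PiE_times_const[OF finite_blocks]
  by (simp add: card_permutations finite_block)

lemma perm_graph_subset_edges_within:
  assumes "\<omega> \<in> perm_families q"
  shows "perm_graph q \<omega> \<subseteq> edges_within \<B>"
proof
  fix e assume "e \<in> perm_graph q \<omega>"
  then obtain B j v where e: "e = {v, \<omega> (B, j) v}" "B \<in> \<B>" "j < q" "v \<in> B" "\<omega> (B, j) v \<noteq> v"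
    by (auto simp: perm_graph_def)
  then have "\<omega> (B, j) v \<in> B" using perm_families_permutes[OF assms] by (simp add: permutes_in_image)
  then show "e \<in> edges_within \<B>" using e by (auto simp: edges_within_def)
qed

lemma perm_graph_edges_at_vertex:
  assumes "\<omega> \<in> perm_families q" "B \<in> \<B>" "v \<in> B"
  shows "{e \<in> perm_graph q \<omega>. v \<in> e}
    \<subseteq> (\<lambda>j. {v, \<omega> (B, j) v}) ` {..<q} \<union> (\<lambda>j. {v, inv (\<omega> (B, j)) v}) ` {..<q}"
proof
  fix e assume "e \<in> {e \<in> perm_graph q \<omega>. v \<in> e}"
  then obtain B' j u where e: "e = {u, \<omega> (B', j) u}" "B' \<in> \<B>" "j < q" "u \<in> B'" "v \<in> e"
    by (auto simp: perm_graph_def)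
  have perm: "\<omega> (B', j) permutes B'" using perm_families_permutes[OF assms(1)] e by auto
  then have "v \<in> B'" using e by (auto simp: permutes_in_image)
  then have [simp]: "B' = B" using assms e block_unique by blast
  consider "v = u" | "v = \<omega> (B, j) u" using e by auto
  then show "e \<in> (\<lambda>j. {v, \<omega> (B, j) v}) ` {..<q} \<union> (\<lambda>j. {v, inv (\<omega> (B, j)) v}) ` {..<q}"
  proof cases
    case 2
    then have "u = inv (\<omega> (B, j)) v" using perm by (simp add: permutes_inverses)
    then have "e = {v, inv (\<omega> (B, j)) v}" using e 2 by auto
    then show ?thesis using e by auto
  qed (use e in auto)
qed

lemma vertex_degree_perm_graph_le:
  assumes "\<omega> \<in> perm_families q"
  shows "vertex_degree (perm_graph q \<omega>) v \<le> 2 * q"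
proof (cases "\<exists>B\<in>\<B>. v \<in> B")
  case True
  then obtain B where "B \<in> \<B>" "v \<in> B" by blast
  then have "vertex_degree (perm_graph q \<omega>) v
      \<le> card ((\<lambda>j. {v, \<omega> (B, j) v}) ` {..<q} \<union> (\<lambda>j. {v, inv (\<omega> (B, j)) v}) ` {..<q})"
    unfolding vertex_degree_def
    by (intro card_mono perm_graph_edges_at_vertex[OF assms]) auto
  also have "\<dots> \<le> card ((\<lambda>j. {v, \<omega> (B, j) v}) ` {..<q})
      + card ((\<lambda>j. {v, inv (\<omega> (B, j)) v}) ` {..<q})"
    by (rule card_Un_le)
  also have "\<dots> \<le> card {..<q} + card {..<q}" by (intro add_mono card_image_le) auto
  finally show ?thesis by simp
next
  case False
  then have "{e \<in> perm_graph q \<omega>. v \<in> e} = {}"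
    using perm_graph_subset_edges_within[OF assms] by (auto simp: edges_within_def)
  then show ?thesis unfolding vertex_degree_def by (simp only: card.empty)
qed

lemma avoiding_families_subset:
  assumes "F \<subseteq> edges_within \<B>"
  shows "{\<omega> \<in> perm_families q. perm_graph q \<omega> \<inter> F = {}}
    \<subseteq> (\<Pi>\<^sub>E (B, j)\<in>\<B> \<times> {..<q}. {\<sigma>. \<sigma> permutes B \<and> (\<forall>v\<in>B. {v, \<sigma> v} \<notin> F)})"
proof
  fix \<omega> assume \<omega>: "\<omega> \<in> {\<omega> \<in> perm_families q. perm_graph q \<omega> \<inter> F = {}}"
  have "{v, \<omega> (B, j) v} \<notin> F" if "B \<in> \<B>" "j < q" "v \<in> B" for B j v
  proof (cases "\<omega> (B, j) v = v")
    case True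
    then show ?thesis using assms by (auto simp: edges_within_def)
  next
    case False
    then have "{v, \<omega> (B, j) v} \<in> perm_graph q \<omega>" using that by (auto simp: perm_graph_def)
    then show ?thesis using \<omega> by auto
  qed
  then show "\<omega> \<in> (\<Pi>\<^sub>E (B, j)\<in>\<B> \<times> {..<q}. {\<sigma>. \<sigma> permutes B \<and> (\<forall>v\<in>B. {v, \<sigma> v} \<notin> F)})"
    using \<omega> by (auto simp: perm_families_def PiE_iff)
qed

lemma card_avoiding_families_le:
  assumes F: "F \<subseteq> edges_within \<B>"
    and "2 \<le> m" "\<And>B v. B \<in> \<B> \<Longrightarrow> v \<in> B \<Longrightarrow> vertex_degree F v + m \<le> card B"
  shows "real (card {\<omega> \<in> perm_families q. perm_graph q \<omega> \<inter> F = {}})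
    \<le> card (perm_families q)
      * exp (- (row_gain m * q * (\<Sum>B\<in>\<B>. (\<Sum>v\<in>B. vertex_degree F v) / card B)))"
proof -
  let ?avoiding = "\<lambda>B. {\<sigma>. \<sigma> permutes B \<and> (\<forall>v\<in>B. {v, \<sigma> v} \<notin> F)}"
  let ?gain = "\<lambda>B. row_gain m * (\<Sum>v\<in>B. vertex_degree F v) / card B"
  have fin: "finite (?avoiding B)" if "B \<in> \<B>" for B
    using finite_permutations[OF finite_block[OF that]] by (rule rev_finite_subset) auto
  have "card {\<omega> \<in> perm_families q. perm_graph q \<omega> \<inter> F = {}}
      \<le> card (\<Pi>\<^sub>E (B, j)\<in>\<B> \<times> {..<q}. ?avoiding B)"
    using finite_blocks fin by (intro card_mono avoiding_families_subset[OF F] finite_PiE) auto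
  also have "\<dots> = (\<Prod>B\<in>\<B>. card (?avoiding B)) ^ q"
    by (rule card_PiE_times_const[OF finite_blocks])
  finally have "real (card {\<omega> \<in> perm_families q. perm_graph q \<omega> \<inter> F = {}})
      \<le> (\<Prod>B\<in>\<B>. card (?avoiding B)) ^ q"
    by (rule of_nat_mono)
  also have "\<dots> = (\<Prod>B\<in>\<B>. real (card (?avoiding B))) ^ q" by simp
  also have "\<dots> \<le> (\<Prod>B\<in>\<B>. fact (card B) * exp (- ?gain B)) ^ q"
  proof (intro power_mono prod_mono conjI)
    fix B assume B: "B \<in> \<B>"
    have "card {u. {v, u} \<in> F} = vertex_degree F v" for v
      using F by (intro card_neighbours) (auto simp: edges_within_def)
    then show "real (card (?avoiding B)) \<le> fact (card B) * exp (- ?gain B)"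
      using card_permutes_avoiding_le[of B m "\<lambda>v. {u. {v, u} \<in> F}"]
        finite_block[OF B] neighbours_subset_block[OF F B] assms(2) assms(3)[OF B] by simp
  qed (auto intro: prod_nonneg)
  also have "\<dots> = card (perm_families q) * exp (\<Sum>B\<in>\<B>. - ?gain B) ^ q"
    by (simp add: card_perm_families prod.distrib power_mult_distrib exp_sum finite_blocks)
  also have "exp (\<Sum>B\<in>\<B>. - ?gain B) ^ q
      = exp (- (row_gain m * q * (\<Sum>B\<in>\<B>. (\<Sum>v\<in>B. vertex_degree F v) / card B)))"
    by (simp add: sum_negf sum_distrib_left mult_ac flip: exp_of_nat_mult)
  finally show ?thesis .
qed

end

section \<open>Adversaries that see their own stream\<close>

lemma finite_edges_on: "finite (edges_on n)"
  unfolding edges_on_def by (rule finite_subset[of _ "Pow {1..n}"]) auto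

lemma valid_stream_iff_vertex_degree:
  "valid_stream n L es \<longleftrightarrow>
     distinct es \<and> set es \<subseteq> edges_on n \<and> (\<forall>v\<in>{1..n}. vertex_degree (set es) v \<le> L)"
  by (simp add: valid_stream_def vertex_degree_def)

lemma valid_stream_prefix: "valid_stream n L (xs @ ys) \<Longrightarrow> valid_stream n L xs"
  unfolding valid_stream_iff_vertex_degree by (auto intro: order_trans[OF vertex_degree_mono])

lemma valid_stream_mono: "valid_stream n L es \<Longrightarrow> L \<le> L' \<Longrightarrow> valid_stream n L' es"
  unfolding valid_stream_def by fastforce

lemma ex_valid_stream:
  assumes "E \<subseteq> edges_on n" "\<And>v. vertex_degree E v \<le> d"
  shows "\<exists>es. valid_stream n d es \<and> set es = E"
proof -
  obtain es where "set es = E" "distinct es"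
    using finite_distinct_list[OF finite_subset[OF assms(1) finite_edges_on]] by blast
  then show ?thesis using assms by (auto simp: valid_stream_iff_vertex_degree)
qed

text \<open>An adversary may look at its own stream, because it can recompute it from the outputs:
  \<open>rev_tokens step cs\<close> is the stream played against the outputs \<open>cs\<close>, newest first.\<close>

type_synonym strategy = "edge list \<Rightarrow> coloring list \<Rightarrow> edge option"

primrec rev_tokens :: "strategy \<Rightarrow> coloring list \<Rightarrow> edge list" where
  "rev_tokens step [] = []"
| "rev_tokens step (c # cs) = rev_tokens step cs @ [the (step (rev_tokens step cs) (rev cs))]"

definition adversary_of :: "strategy \<Rightarrow> adversary" where
  "adversary_of step cs = step (rev_tokens step (rev cs)) cs"

definition guard :: "nat \<Rightarrow> nat \<Rightarrow> strategy \<Rightarrow> strategy" where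
  "guard n L step es cs =
     (case step es cs of
        None \<Rightarrow> None
      | Some e \<Rightarrow> if valid_stream n L (es @ [e]) then Some e else None)"

lemma guard_Some: "guard n L step es cs = Some e \<Longrightarrow> valid_stream n L (es @ [e])"
  by (auto simp: guard_def split: option.splits if_splits)

lemma adv_stream_Nil [simp]: "adv_stream adv [] = []"
  by (simp add: adv_stream_def)

lemma adv_stream_snoc [simp]: "adv_stream adv (cs @ [c]) = adv_stream adv cs @ [the (adv cs)]"
  by (simp add: adv_stream_def)

lemma adversary_of_eq: "adversary_of step cs = step (adv_stream (adversary_of step) cs) cs"
proof -
  have "adv_stream (adversary_of step) cs = rev_tokens step (rev cs)"
    by (induction cs rule: rev_induct) (simp_all add: adversary_of_def)
  then show ?thesis by (simp add: adversary_of_def)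
qed

lemma valid_adversary_guard: "valid_adversary n L (adversary_of (guard n L step))"
  unfolding valid_adversary_def
proof (intro allI impI)
  let ?adv = "adversary_of (guard n L step)"
  fix cs assume "set cs \<subseteq> colorings n \<and> (\<forall>i<length cs. ?adv (take i cs) \<noteq> None)"
  then have "\<forall>i<length cs. ?adv (take i cs) \<noteq> None" by simp
  then show "valid_stream n L (adv_stream ?adv cs)"
  proof (induction cs rule: rev_induct)
    case Nil
    show ?case by (simp add: valid_stream_def)
  next
    case (snoc c cs)
    then have "?adv cs \<noteq> None" by (auto dest: spec[of _ "length cs"])
    then show ?case using guard_Some adversary_of_eq[of "guard n L step" cs] by auto
  qed
qed

lemma interaction_adv_stream:
  "interaction A adv r i = (x, es, cs) \<Longrightarrow> es = adv_stream adv cs \<and> length es = length cs"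
proof (induction i arbitrary: x es cs)
  case (Suc i)
  obtain x' es' cs' where prev: "interaction A adv r i = (x', es', cs')" by (metis prod_cases3)
  show ?case using Suc.prems Suc.IH[OF prev] prev by (auto simp: Let_def split: option.splits)
qed simp

lemma adversary_of_interaction:
  assumes "interaction A (adversary_of step) r i = (x, es, cs)"
  shows "adversary_of step cs = step es cs"
  using interaction_adv_stream[OF assms] adversary_of_eq[of step cs] by simp

lemma interaction_guard_Some:
  assumes "interaction A (adversary_of (guard n L step)) r i = (x, es, cs)"
    and "step es cs = Some e" "valid_stream n L (es @ [e])"
  shows "interaction A (adversary_of (guard n L step)) r (Suc i)
    = (update A r x e, es @ [e], cs @ [query A r (update A r x e)])"
  using assms adversary_of_interaction[OF assms(1)] by (simp add: guard_def Let_def)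

lemma interaction_guard_None:
  assumes "interaction A (adversary_of (guard n L step)) r i = (x, es, cs)" "step es cs = None"
  shows "interaction A (adversary_of (guard n L step)) r (Suc i) = (x, es, cs)"
  using assms adversary_of_interaction[OF assms(1)] by (simp add: guard_def)

lemma all_proper_last:
  assumes "all_proper n K A adv r" "interaction A adv r i = (x, es, cs)" "cs \<noteq> []"
  shows "proper_coloring n K (set es) (last cs)"
proof -
  have "\<forall>j<length cs. proper_coloring n K (set (take (Suc j) es)) (cs ! j)"
    using assms(1)[unfolded all_proper_def, rule_format, of i] assms(2) by simp
  then have "proper_coloring n K (set (take (length cs) es)) (last cs)"
    using assms(3) by (auto simp: last_conv_nth dest: spec[of _ "length cs - 1"])
  moreover have "length es = length cs" using interaction_adv_stream[OF assms(2)] by blast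
  ultimately show ?thesis by simp
qed

section \<open>The greedy adversary\<close>

locale coloring_game = disjoint_blocks \<B> for \<B> :: "nat set set" +
  fixes n K d_prefix d_greedy :: nat
  assumes block_subset: "B \<in> \<B> \<Longrightarrow> B \<subseteq> {1..n}"
begin

definition candidate :: "edge set \<Rightarrow> coloring \<Rightarrow> edge \<Rightarrow> bool" where
  "candidate F c e \<longleftrightarrow> (\<exists>B\<in>\<B>. \<exists>u\<in>B. \<exists>v\<in>B. u \<noteq> v \<and> e = {u, v} \<and> c u = c v \<and>
     vertex_degree F u < d_greedy \<and> vertex_degree F v < d_greedy)"

definition greedy :: "edge set \<Rightarrow> coloring \<Rightarrow> edge option" where
  "greedy F c = (if \<exists>e. candidate F c e then Some (SOME e. candidate F c e) else None)"

definition prefix_then_greedy :: "edge list \<Rightarrow> strategy" where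
  "prefix_then_greedy gs es cs =
     (if length es < length gs then Some (gs ! length es)
      else greedy (set (drop (length gs) es)) (last cs))"

definition game_adversary :: "edge list \<Rightarrow> adversary" where
  "game_adversary gs = adversary_of (guard n (d_prefix + d_greedy) (prefix_then_greedy gs))"

primrec greedy_run :: "'r stream_alg \<Rightarrow> 'r \<Rightarrow> bool list \<Rightarrow> nat \<Rightarrow> bool list \<times> edge list" where
  "greedy_run A r x 0 = (x, [])"
| "greedy_run A r x (Suc j) = (case greedy_run A r x j of (y, F) \<Rightarrow>
     (case greedy (set F) (query A r y) of
        None \<Rightarrow> (y, F)
      | Some e \<Rightarrow> (update A r y e, F @ [e])))"

text \<open>The greedy phase inserts at most \<open>card (edges_within \<B>)\<close> edges, so this run ends stuck.\<close>

definition greedy_edges :: "'r stream_alg \<Rightarrow> 'r \<Rightarrow> bool list \<Rightarrow> edge set" where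
  "greedy_edges A r x = set (snd (greedy_run A r x (Suc (card (edges_within \<B>)))))"

definition saturated :: "edge set \<Rightarrow> bool" where
  "saturated F \<longleftrightarrow> F \<subseteq> edges_within \<B> \<and> (\<forall>v. vertex_degree F v \<le> d_greedy) \<and>
     (\<forall>B\<in>\<B>. d_greedy * (card B - K) \<le> (\<Sum>v\<in>B. vertex_degree F v))"

lemma edges_within_subset_edges_on: "edges_within \<B> \<subseteq> edges_on n"
  using block_subset by (fastforce simp: edges_within_def edges_on_def)

lemma candidate_edges_within: "candidate F c e \<Longrightarrow> e \<in> edges_within \<B>"
  by (auto simp: candidate_def edges_within_def)

lemma candidate_notin_proper:
  assumes "candidate F c e" "proper_coloring n K E c"
  shows "e \<notin> E"
  using assms block_subset unfolding candidate_def proper_coloring_def by blast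

lemma vertex_degree_insert_candidate:
  assumes "candidate F c e" "\<And>v. vertex_degree F v \<le> d_greedy"
  shows "vertex_degree (insert e F) v \<le> d_greedy"
proof -
  have "vertex_degree (insert e F) v \<le> of_bool (v \<in> e) + vertex_degree F v"
    using vertex_degree_Un_le[of "{e}" F v] by simp
  also have "\<dots> \<le> d_greedy"
    using assms(1) assms(2)[of v] by (auto simp: candidate_def)
  finally show ?thesis .
qed

lemma greedy_Some: "greedy F c = Some e \<Longrightarrow> candidate F c e"
  unfolding greedy_def by (auto split: if_splits intro: someI)

lemma greedy_None: "greedy F c = None \<Longrightarrow> \<not> candidate F c e"
  unfolding greedy_def by (auto split: if_splits)

lemma greedy_run_within_degree:
  assumes "greedy_run A r x j = (y, F)"
  shows "set F \<subseteq> edges_within \<B> \<and> (\<forall>v. vertex_degree (set F) v \<le> d_greedy)"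
  using assms
proof (induction j arbitrary: y F)
  case (Suc j)
  obtain y' F' where prev: "greedy_run A r x j = (y', F')" by fastforce
  show ?case
  proof (cases "greedy (set F') (query A r y')")
    case None
    then show ?thesis using Suc.prems Suc.IH[OF prev] prev by simp
  next
    case (Some e)
    from greedy_Some[OF this] show ?thesis
      using Some Suc.prems Suc.IH[OF prev] prev candidate_edges_within
        vertex_degree_insert_candidate by auto
  qed
qed simp

lemma length_greedy_run:
  assumes "greedy_run A r x j = (y, F)" "greedy (set F) (query A r y) \<noteq> None"
  shows "length F = j"
  using assms
proof (induction j arbitrary: y F)
  case (Suc j)
  obtain y' F' where prev: "greedy_run A r x j = (y', F')" by fastforce
  show ?case
  proof (cases "greedy (set F') (query A r y')")
    case None
    then show ?thesis using Suc.prems prev by auto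
  next
    case (Some e)
    then show ?thesis using Suc prev by auto
  qed
qed simp

lemma saturated_if_stuck:
  assumes "proper_coloring n K E c" "greedy F c = None"
    and "F \<subseteq> edges_within \<B>" "\<And>v. vertex_degree F v \<le> d_greedy"
  shows "saturated F"
  unfolding saturated_def
proof (intro conjI ballI)
  fix B assume B: "B \<in> \<B>"
  let ?U = "{v \<in> B. vertex_degree F v < d_greedy}"
  have "inj_on c ?U"
  proof (rule inj_onI, rule ccontr)
    fix u v assume "u \<in> ?U" "v \<in> ?U" "c u = c v" "u \<noteq> v"
    then have "candidate F c {u, v}" unfolding candidate_def using B by blast
    then show False using greedy_None[OF assms(2)] by blast
  qed
  then have "card ?U = card (c ` ?U)" by (simp add: card_image)
  also have "\<dots> \<le> card (c ` {1..n})" using block_subset[OF B] by (intro card_mono) auto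
  also have "\<dots> \<le> K" using assms(1) by (simp add: proper_coloring_def)
  finally have "card B - K \<le> card (B - ?U)"
    using finite_block[OF B] by (simp add: card_Diff_subset)
  then have "d_greedy * (card B - K) \<le> (\<Sum>v\<in>B - ?U. d_greedy)" by simp
  also have "\<dots> \<le> (\<Sum>v\<in>B - ?U. vertex_degree F v)" by (intro sum_mono) auto
  also have "\<dots> \<le> (\<Sum>v\<in>B. vertex_degree F v)"
    using finite_block[OF B] by (intro sum_mono2) auto
  finally show "d_greedy * (card B - K) \<le> (\<Sum>v\<in>B. vertex_degree F v)" .
qed (use assms in auto)

lemma valid_stream_append:
  assumes "valid_stream n d_prefix gs" "distinct (gs @ F)"
    and "set F \<subseteq> edges_within \<B>" "\<And>v. vertex_degree (set F) v \<le> d_greedy"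
  shows "valid_stream n (d_prefix + d_greedy) (gs @ F)"
  unfolding valid_stream_iff_vertex_degree
proof (intro conjI ballI)
  fix v assume v: "v \<in> {1..n}"
  have "vertex_degree (set (gs @ F)) v \<le> vertex_degree (set gs) v + vertex_degree (set F) v"
    using vertex_degree_Un_le by simp
  also have "\<dots> \<le> d_prefix + d_greedy"
    using assms v by (intro add_mono) (auto simp: valid_stream_iff_vertex_degree)
  finally show "vertex_degree (set (gs @ F)) v \<le> d_prefix + d_greedy" .
qed (use assms edges_within_subset_edges_on in \<open>auto simp: valid_stream_def\<close>)

lemma interaction_prefix:
  assumes "valid_stream n d_prefix gs" "i \<le> length gs"
  shows "\<exists>cs. interaction A (game_adversary gs) r i
      = (foldl (update A r) (init A r) (take i gs), take i gs, cs) \<and> length cs = i \<and>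
    (i > 0 \<longrightarrow> last cs = query A r (foldl (update A r) (init A r) (take i gs)))"
  using assms(2)
proof (induction i)
  case (Suc i)
  have snoc: "take (Suc i) gs = take i gs @ [gs ! i]"
    using Suc.prems by (simp add: take_Suc_conv_app_nth)
  have "valid_stream n (d_prefix + d_greedy) (take (Suc i) gs @ drop (Suc i) gs)"
    using valid_stream_mono[OF assms(1)] by simp
  then have "valid_stream n (d_prefix + d_greedy) (take i gs @ [gs ! i])"
    using valid_stream_prefix snoc by metis
  moreover have "prefix_then_greedy gs (take i gs) cs = Some (gs ! i)" for cs
    using Suc.prems by (simp add: prefix_then_greedy_def)
  ultimately show ?case
    using Suc interaction_guard_Some unfolding game_adversary_def snoc by fastforce
qed simp

lemma interaction_greedy_run:
  fixes A :: "'r stream_alg"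
  assumes gs: "valid_stream n d_prefix gs" "gs \<noteq> []"
    and proper: "all_proper n K A (game_adversary gs) r"
    and run: "greedy_run A r (foldl (update A r) (init A r) gs) j = (y, F)"
  shows "\<exists>cs. interaction A (game_adversary gs) r (length gs + j) = (y, gs @ F, cs) \<and>
    cs \<noteq> [] \<and> last cs = query A r y \<and> distinct (gs @ F)"
  using run
proof (induction j arbitrary: y F)
  case 0
  then show ?case
    using interaction_prefix[OF gs(1), of "length gs" A r] gs
    by (auto simp: valid_stream_def)
next
  case (Suc j)
  let ?I = "interaction A (game_adversary gs) r"
  obtain y' F' where run': "greedy_run A r (foldl (update A r) (init A r) gs) j = (y', F')"
    by fastforce
  then obtain cs where played: "?I (length gs + j) = (y', gs @ F', cs)" "cs \<noteq> []"
      "last cs = query A r y'" "distinct (gs @ F')"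
    using Suc.IH by blast
  have token: "prefix_then_greedy gs (gs @ F') cs = greedy (set F') (query A r y')"
    using played(3) by (simp add: prefix_then_greedy_def)
  show ?case
  proof (cases "greedy (set F') (query A r y')")
    case None
    then show ?thesis
      using played interaction_guard_None[OF played(1)[unfolded game_adversary_def]] Suc.prems
        run' token
      by (simp add: game_adversary_def del: interaction.simps)
  next
    case (Some e)
    then have yF: "y = update A r y' e" "F = F' @ [e]" using Suc.prems run' by auto
    have "proper_coloring n K (set (gs @ F')) (query A r y')"
      using all_proper_last[OF proper played(1,2)] played(3) by simp
    then have "e \<notin> set (gs @ F')" by (rule candidate_notin_proper[OF greedy_Some[OF Some]])
    then have dist: "distinct (gs @ F)" using played(4) yF by simp
    then have "valid_stream n (d_prefix + d_greedy) (gs @ F)"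
      using greedy_run_within_degree[OF Suc.prems] by (intro valid_stream_append[OF gs(1)]) auto
    then show ?thesis
      using interaction_guard_Some[OF played(1)[unfolded game_adversary_def]] Some token dist yF
      by (simp add: game_adversary_def del: interaction.simps)
  qed
qed

lemma greedy_edges_saturated_disjoint:
  assumes "valid_stream n d_prefix gs" "gs \<noteq> []" "all_proper n K A (game_adversary gs) r"
  defines "x \<equiv> foldl (update A r) (init A r) gs"
  shows "saturated (greedy_edges A r x)" "greedy_edges A r x \<inter> set gs = {}"
proof -
  let ?J = "Suc (card (edges_within \<B>))"
  obtain y F where run: "greedy_run A r x ?J = (y, F)" by fastforce
  then obtain cs where played:
      "interaction A (game_adversary gs) r (length gs + ?J) = (y, gs @ F, cs)"
      "cs \<noteq> []" "last cs = query A r y" "distinct (gs @ F)"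
    using interaction_greedy_run[OF assms(1-3)] unfolding x_def by blast
  have F: "set F \<subseteq> edges_within \<B>" "\<And>v. vertex_degree (set F) v \<le> d_greedy"
    using greedy_run_within_degree[OF run] by auto
  have "length F = card (set F)" using played(4) by (simp add: distinct_card)
  also have "\<dots> \<le> card (edges_within \<B>)" using F(1) finite_edges_within by (rule card_mono[rotated])
  finally have "greedy (set F) (query A r y) = None" using length_greedy_run[OF run] by fastforce
  moreover have "proper_coloring n K (set (gs @ F)) (query A r y)"
    using all_proper_last[OF assms(3) played(1,2)] played(3) by simp
  ultimately have "saturated (set F)" using F by (intro saturated_if_stuck)
  then show "saturated (greedy_edges A r x)" "greedy_edges A r x \<inter> set gs = {}"
    using played(4) run by (auto simp: greedy_edges_def)
qed

lemma ex_stream_containing_perm_graph: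
  assumes "\<omega> \<in> perm_families q" "q > 0" "n \<ge> 2"
  shows "\<exists>gs. valid_stream n (2 * q) gs \<and> gs \<noteq> [] \<and> perm_graph q \<omega> \<subseteq> set gs"
proof (cases "perm_graph q \<omega> = {}")
  case True
  \<comment> \<open>The greedy phase needs a coloring to start from, so the first phase must not be empty.\<close>
  have "valid_stream n (2 * q) [{1, 2}]"
    using assms by (auto simp: valid_stream_iff_vertex_degree edges_on_def)
  with True show ?thesis by blast
next
  case False
  have "perm_graph q \<omega> \<subseteq> edges_on n"
    using perm_graph_subset_edges_within[OF assms(1)] edges_within_subset_edges_on by blast
  then obtain gs where "valid_stream n (2 * q) gs" "set gs = perm_graph q \<omega>"
    using ex_valid_stream vertex_degree_perm_graph_le[OF assms(1)] by meson
  with False show ?thesis by (intro exI[of _ gs]) auto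
qed

definition avoidance_exponent :: "nat \<Rightarrow> nat \<Rightarrow> real" where
  "avoidance_exponent m q = row_gain m * q * d_greedy * (\<Sum>B\<in>\<B>. real (card B - K) / card B)"

lemma card_avoiding_saturated_le:
  assumes "saturated F" "2 \<le> m" "\<And>B. B \<in> \<B> \<Longrightarrow> d_greedy + m \<le> card B"
  shows "real (card {\<omega> \<in> perm_families q. perm_graph q \<omega> \<inter> F = {}})
    \<le> card (perm_families q) * exp (- avoidance_exponent m q)"
proof -
  have F: "F \<subseteq> edges_within \<B>" "\<And>v. vertex_degree F v \<le> d_greedy"
      "\<And>B. B \<in> \<B> \<Longrightarrow> d_greedy * (card B - K) \<le> (\<Sum>v\<in>B. vertex_degree F v)"
    using assms(1) by (auto simp: saturated_def)
  have "d_greedy * (\<Sum>B\<in>\<B>. real (card B - K) / card B)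
      = (\<Sum>B\<in>\<B>. real (d_greedy * (card B - K)) / card B)"
    by (simp add: sum_distrib_left)
  also have "\<dots> \<le> (\<Sum>B\<in>\<B>. real (\<Sum>v\<in>B. vertex_degree F v) / card B)"
    using F(3) by (intro sum_mono divide_right_mono of_nat_mono) auto
  finally have "row_gain m * q * (d_greedy * (\<Sum>B\<in>\<B>. real (card B - K) / card B))
      \<le> row_gain m * q * (\<Sum>B\<in>\<B>. real (\<Sum>v\<in>B. vertex_degree F v) / card B)"
    using row_gain_nonneg[OF assms(2)] by (intro mult_left_mono) auto
  then have "exp (- (row_gain m * q * (\<Sum>B\<in>\<B>. real (\<Sum>v\<in>B. vertex_degree F v) / card B)))
      \<le> exp (- avoidance_exponent m q)"
    by (simp add: avoidance_exponent_def mult.assoc)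
  moreover have "vertex_degree F v + m \<le> card B" if "B \<in> \<B>" for B v
    using F(2)[of v] assms(3)[OF that] by linarith
  ultimately show ?thesis
    using card_avoiding_families_le[OF F(1) assms(2), of q]
    by (meson mult_left_mono of_nat_0_le_iff order_trans)
qed

end

section \<open>The union bound over the states\<close>

lemma finite_states: "finite (states s)"
  using finite_lists_length_eq[of "UNIV :: bool set" s] by (simp add: states_def)

lemma card_states: "card (states s) = 2 ^ s"
  using card_lists_length_eq[of "UNIV :: bool set" s] by (simp add: states_def)

lemma init_in_states: "streaming_algorithm M n s A \<Longrightarrow> r \<in> space M \<Longrightarrow> init A r \<in> states s"
  using measurable_space[of "init A" M "count_space (states s)" r]
  by (simp add: streaming_algorithm_def)

lemma update_in_states:
  "streaming_algorithm M n s A \<Longrightarrow> r \<in> space M \<Longrightarrow> x \<in> states s \<Longrightarrow> e \<in> edges_on n \<Longrightarrow>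
    update A r x e \<in> states s"
  using measurable_space[of "\<lambda>r. update A r x e" M "count_space (states s)" r]
  by (simp add: streaming_algorithm_def)

lemma foldl_update_in_states:
  assumes "streaming_algorithm M n s A" "r \<in> space M" "x \<in> states s" "set es \<subseteq> edges_on n"
  shows "foldl (update A r) x es \<in> states s"
  using assms(3,4)
  by (induction es arbitrary: x) (auto intro: update_in_states[OF assms(1,2)])

lemma (in prob_space) ex_card_ge_of_prob_ge:
  fixes p :: real
  assumes "finite I" "p > 0" "\<And>i. i \<in> I \<Longrightarrow> p \<le> prob (S i)"
  shows "\<exists>r\<in>space M. card I * p \<le> card {i \<in> I. r \<in> S i}"
proof (rule ccontr)
  \<comment> \<open>A set that is not measurable has measure \<open>0\<close>, which is less than \<open>p\<close>.\<close>
  have S [measurable]: "S i \<in> events" if "i \<in> I" for i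
    using assms(2) assms(3)[OF that] measure_notin_sets[of "S i" M] by fastforce
  have count: "(\<Sum>i\<in>I. indicator (S i) r) = real (card {i \<in> I. r \<in> S i})" for r
    using assms(1) by (simp add: indicator_def flip: of_bool_def) (simp add: Int_def)
  assume "\<not> ?thesis"
  then have "(\<Sum>i\<in>I. indicator (S i) r) < card I * p" if "r \<in> space M" for r
    unfolding count using that by force
  then have "expectation (\<lambda>r. \<Sum>i\<in>I. indicator (S i) r) < card I * p"
    using S by (intro expectation_less Bochner_Integration.integrable_sum)
      (auto intro!: AE_I2 simp: less_top[symmetric])
  moreover have "card I * p \<le> (\<Sum>i\<in>I. prob (S i))"
    using assms(3) by (intro sum_bounded_below)
  moreover have "(\<Sum>i\<in>I. prob (S i)) = expectation (\<lambda>r. \<Sum>i\<in>I. indicator (S i) r)"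
    using S by (simp add: less_top[symmetric])
  ultimately show False by simp
qed

context coloring_game
begin

lemma card_survived_families_le:
  assumes alg: "streaming_algorithm M n s A" "r \<in> space M"
    and gs: "\<And>\<omega>. \<omega> \<in> perm_families q \<Longrightarrow> valid_stream n d_prefix (gs \<omega>)"
      "\<And>\<omega>. \<omega> \<in> perm_families q \<Longrightarrow> gs \<omega> \<noteq> []"
      "\<And>\<omega>. \<omega> \<in> perm_families q \<Longrightarrow> perm_graph q \<omega> \<subseteq> set (gs \<omega>)"
    and slack: "2 \<le> m" "\<And>B. B \<in> \<B> \<Longrightarrow> d_greedy + m \<le> card B"
  shows "real (card {\<omega> \<in> perm_families q. all_proper n K A (game_adversary (gs \<omega>)) r})
    \<le> 2 ^ s * (card (perm_families q) * exp (- avoidance_exponent m q))"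
    (is "real (card ?survived) \<le> 2 ^ s * ?bound")
proof -
  let ?X = "{x \<in> states s. saturated (greedy_edges A r x)}"
  let ?avoiding = "\<lambda>x. {\<omega> \<in> perm_families q. perm_graph q \<omega> \<inter> greedy_edges A r x = {}}"
  have "?survived \<subseteq> (\<Union>x\<in>?X. ?avoiding x)"
  proof
    fix \<omega> assume "\<omega> \<in> ?survived"
    then have \<omega>: "\<omega> \<in> perm_families q" "all_proper n K A (game_adversary (gs \<omega>)) r" by auto
    let ?x = "foldl (update A r) (init A r) (gs \<omega>)"
    have "?x \<in> states s"
      using foldl_update_in_states[OF alg init_in_states[OF alg]] gs(1)[OF \<omega>(1)]
      by (simp add: valid_stream_def)
    then show "\<omega> \<in> (\<Union>x\<in>?X. ?avoiding x)"
      using greedy_edges_saturated_disjoint[OF gs(1,2)[OF \<omega>(1)] \<omega>(2)] gs(3)[OF \<omega>(1)] \<omega>(1)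
      by (intro UN_I[of ?x]) auto
  qed
  then have "card ?survived \<le> card (\<Union>x\<in>?X. ?avoiding x)"
    using finite_states finite_perm_families by (intro card_mono) auto
  also have "\<dots> \<le> (\<Sum>x\<in>?X. card (?avoiding x))"
    using finite_states by (intro card_UN_le) auto
  finally have "real (card ?survived) \<le> (\<Sum>x\<in>?X. card (?avoiding x))"
    by (rule of_nat_mono)
  also have "\<dots> = (\<Sum>x\<in>?X. real (card (?avoiding x)))" by (rule of_nat_sum)
  also have "\<dots> \<le> (\<Sum>x\<in>?X. ?bound)"
    by (intro sum_mono card_avoiding_saturated_le[OF _ slack]) auto
  also have "\<dots> = card ?X * ?bound" by simp
  also have "\<dots> \<le> 2 ^ s * ?bound"
  proof (rule mult_right_mono)
    have "card ?X \<le> 2 ^ s"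
      unfolding card_states[symmetric] using finite_states by (intro card_mono) auto
    then show "real (card ?X) \<le> 2 ^ s" by (simp flip: of_nat_le_iff)
  qed simp
  finally show ?thesis .
qed

theorem state_space_lower_bound:
  fixes p :: real
  assumes alg: "streaming_algorithm M n s A"
    and robust: "robust_coloring M n (d_prefix + d_greedy) K p A" "p > 0"
    and prefix: "d_prefix = 2 * q" "q > 0" "n \<ge> 2"
    and slack: "2 \<le> m" "\<And>B. B \<in> \<B> \<Longrightarrow> d_greedy + m \<le> card B"
  shows "avoidance_exponent m q + ln p \<le> s * ln 2"
    (is "?E + ln p \<le> _")
proof -
  interpret prob_space M using alg by (simp add: streaming_algorithm_def)
  let ?\<Omega> = "perm_families q"
  have "\<forall>\<omega>\<in>?\<Omega>. \<exists>gs. valid_stream n d_prefix gs \<and> gs \<noteq> [] \<and> perm_graph q \<omega> \<subseteq> set gs"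
    unfolding prefix(1) using ex_stream_containing_perm_graph prefix(2,3) by simp
  then obtain gs where gs: "\<And>\<omega>. \<omega> \<in> ?\<Omega> \<Longrightarrow> valid_stream n d_prefix (gs \<omega>)"
      "\<And>\<omega>. \<omega> \<in> ?\<Omega> \<Longrightarrow> gs \<omega> \<noteq> []" "\<And>\<omega>. \<omega> \<in> ?\<Omega> \<Longrightarrow> perm_graph q \<omega> \<subseteq> set (gs \<omega>)"
    unfolding bchoice_iff by blast
  define survived where
    "survived \<omega> = {r \<in> space M. all_proper n K A (game_adversary (gs \<omega>)) r}" for \<omega>
  have "p \<le> prob (survived \<omega>)" for \<omega>
    using robust(1) valid_adversary_guard
    by (simp add: robust_coloring_def survived_def game_adversary_def)
  then obtain r where r: "r \<in> space M" "card ?\<Omega> * p \<le> card {\<omega> \<in> ?\<Omega>. r \<in> survived \<omega>}"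
    using ex_card_ge_of_prob_ge[OF finite_perm_families robust(2), where S = survived] by blast
  note r(2)
  also have "real (card {\<omega> \<in> ?\<Omega>. r \<in> survived \<omega>}) \<le> 2 ^ s * (card ?\<Omega> * exp (- ?E))"
    using card_survived_families_le[OF alg r(1) gs slack] r(1) by (simp add: survived_def)
  also have "\<dots> = card ?\<Omega> * (2 ^ s * exp (- ?E))" by simp
  finally have "p \<le> 2 ^ s * exp (- ?E)"
    by (simp add: card_perm_families prod_pos zero_less_power)
  then have "ln p \<le> ln (2 ^ s * exp (- ?E))" using robust(2) by (intro ln_mono) auto
  then show ?thesis by (simp add: ln_mult ln_realpow)
qed

end

section \<open>The space bound\<close>

lemma degree_bound_ge_64:
  fixes L n K :: nat
  assumes "2 * K \<le> n" "L + 1 \<le> K" "real L \<ge> 12 * ln (4 * real n)"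
  shows "L \<ge> 64"
proof -
  have power_two: "8 * m \<le> L" if "2 ^ m \<le> 4 * n" for m
  proof -
    have "m * (2/3) \<le> m * ln 2"
      using ln2_ge_two_thirds by (intro mult_left_mono) auto
    also have "\<dots> = ln (2 ^ m)" by (simp add: ln_realpow)
    also have "\<dots> \<le> ln (4 * real n)"
    proof (rule ln_mono)
      have "real (2 ^ m) \<le> real (4 * n)" using that by (rule of_nat_mono)
      then show "2 ^ m \<le> 4 * real n" by simp
    qed simp
    finally have "8 * real m \<le> real L" using assms(3) by simp
    then show ?thesis by linarith
  qed
  have n: "2 * L + 2 \<le> n" using assms by simp
  have "24 \<le> L" using power_two[of 3] n by simp
  then have "56 \<le> L" using power_two[of 7] n by simp
  then show ?thesis using power_two[of 8] n by simp
qed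

lemma ex_disjoint_subsets:
  assumes "finite A" "N > 0" "k * N \<le> card A"
  shows "\<exists>\<B>. finite \<B> \<and> card \<B> = k \<and> disjoint \<B> \<and> (\<forall>B\<in>\<B>. B \<subseteq> A \<and> card B = N)"
  using assms(3)
proof (induction k)
  case 0
  show ?case by (intro exI[of _ "{}"]) auto
next
  case (Suc k)
  then obtain \<B> where \<B>: "finite \<B>" "card \<B> = k" "disjoint \<B>" "\<forall>B\<in>\<B>. B \<subseteq> A \<and> card B = N"
    by auto
  have "card (\<Union>\<B>) \<le> sum card \<B>" by (rule card_Union_le_sum_card)
  also have "\<dots> = k * N" using \<B> by simp
  finally have "card (\<Union>\<B>) \<le> k * N" .
  moreover have "finite (\<Union>\<B>)" using assms(1) \<B>(4) by (blast intro: finite_subset[of _ A])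
  ultimately have "N \<le> card (A - \<Union>\<B>)"
    using Suc.prems diff_card_le_card_Diff[of "\<Union>\<B>" A] by simp
  then obtain T where T: "T \<subseteq> A - \<Union>\<B>" "card T = N" by (rule obtain_subset_with_card_n)
  then have "T \<noteq> {}" using assms(2) by auto
  then have "T \<notin> \<B>" using T(1) by blast
  moreover have "disjoint (insert T \<B>)"
    using \<B>(3) T(1) by (auto simp: pairwise_insert disjnt_def)
  ultimately show ?case using \<B> T by (intro exI[of _ "insert T \<B>"]) auto
qed

text \<open>The window for \<open>N\<close> comes from \<open>(N - K) / N\<^sup>2\<close>, which has the same value \<open>2 / (9 K)\<close> at
  \<open>N = 3 K / 2\<close> and at \<open>N = 3 K\<close>, and is larger in between.\<close>

lemma ex_block_count_and_size:
  fixes n K :: nat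
  assumes "K > 0" "2 * K \<le> n"
  obtains k N where "k * N \<le> n" "n < k * (N + 1)" "N \<le> 3 * K" "3 * K < 2 * (N + 1)"
proof -
  define d where "d = (n - 1) div (3 * K)"
  define N where "N = n div Suc d"
  have d: "3 * K * d \<le> n - 1" "n - 1 < 3 * K * Suc d"
    using assms(1) dividend_less_times_div[of "3 * K" "n - 1"] by (simp_all add: d_def)
  have "3 * K * Suc d \<le> 2 * n"
  proof (cases "d = 0")
    case False
    then have "3 * K \<le> 3 * K * d" by simp
    then show ?thesis using d(1) unfolding mult_Suc_right by linarith
  qed (use assms(2) in simp)
  moreover have N: "Suc d * N \<le> n" "n < Suc d * (N + 1)"
    unfolding N_def
    using times_div_less_eq_dividend[of "Suc d" n] dividend_less_times_div[of "Suc d" n]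
    by (simp_all only: distrib_left mult_1_right add.commute zero_less_Suc)
  ultimately have "Suc d * (3 * K) < Suc d * (2 * (N + 1))" by (simp add: algebra_simps)
  moreover have "Suc d * N \<le> Suc d * (3 * K)" using N(1) d(2) by (simp add: algebra_simps)
  ultimately show thesis using that[OF N] unfolding mult_less_cancel1 mult_le_cancel1 by simp
qed

lemma block_size_quadratic:
  fixes N K :: real
  assumes "3 * K - 1 \<le> 2 * N" "N \<le> 3 * K" "K \<ge> 19"
  shows "N * (N + 1) \<le> 19/4 * (N - K) * K"
proof -
  have "0 \<le> (2 * N - (3 * K - 1)) * (3 * K - N) / 2
      + (K - 2) / 8 * (2 * N - (3 * K - 1)) + (K * (K - 19) + 2) / 8"
    using assms by (intro add_nonneg_nonneg divide_nonneg_pos mult_nonneg_nonneg) auto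
  also have "\<dots> = 19/4 * (N - K) * K - N * (N + 1)" by (simp add: field_simps)
  finally show ?thesis by simp
qed

lemma quarter_split_quadratic:
  fixes L :: nat
  assumes "L \<ge> 30"
  shows "99/800 * (real L)\<^sup>2 \<le> real (L div 4) * real (L - 2 * (L div 4))"
proof -
  define t where "t = real (L mod 4)"
  have "L = 4 * (L div 4) + L mod 4" by simp
  then have L: "real L = 4 * real (L div 4) + t" "real (L - 2 * (L div 4)) = 2 * real (L div 4) + t"
    unfolding t_def by linarith+
  have "t \<le> 3" by (simp add: t_def)
  then have "t\<^sup>2 \<le> 3\<^sup>2" by (rule power_mono) (simp add: t_def)
  moreover have "30\<^sup>2 \<le> (real L)\<^sup>2" using assms by (intro power_mono) auto
  moreover have "8 * (real (L div 4) * real (L - 2 * (L div 4))) = (real L)\<^sup>2 - t\<^sup>2"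
    unfolding L by (simp add: power2_eq_square algebra_simps)
  ultimately show ?thesis by simp
qed

lemma n_div_K_le_block_count:
  fixes n k N K :: nat
  assumes "n < k * (N + 1)" "N \<le> 3 * K" "3 * K < 2 * (N + 1)" "K \<ge> 19"
  shows "4/19 * (real n / real K) \<le> real k * (real (N - K) / real N)"
proof -
  have N: "K \<le> N" "N > 0" using assms(3,4) by auto
  have "real n \<le> real k * (real N + 1)"
    using assms(1) by (metis less_imp_le of_nat_1 of_nat_add of_nat_le_iff of_nat_mult)
  then have "real n * N \<le> real k * (real N + 1) * N" by (rule mult_right_mono) simp
  also have "\<dots> = k * (real N * (real N + 1))" by simp
  also have "\<dots> \<le> k * (19/4 * (real N - real K) * real K)"
    using assms by (intro mult_left_mono block_size_quadratic) auto
  finally show ?thesis using N assms(4) by (simp add: field_simps of_nat_diff)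
qed

lemma row_gain_64: "24/25 \<le> row_gain 64"
proof -
  have "ln (64 :: real) = 6 * ln 2" using ln_realpow[of 2 6] by simp
  then show ?thesis using ln2_le_25_over_36 by (simp add: row_gain_def)
qed

lemma space_bound_le_exponent:
  fixes L n K k N :: nat
  assumes "L \<ge> 30" "n < k * (N + 1)" "N \<le> 3 * K" "3 * K < 2 * (N + 1)" "K \<ge> 19"
  shows "1/40 * (real n * (real L)\<^sup>2 / real K)
    \<le> row_gain 64 * real (L div 4) * real (L - 2 * (L div 4)) * (real k * (real (N - K) / real N))"
proof -
  have "1/40 * (real n * (real L)\<^sup>2 / real K)
      \<le> 24/25 * (99/800) * (4/19) * (real n * (real L)\<^sup>2 / real K)"
    by (rule mult_right_mono) simp_all
  also have "\<dots> = 24/25 * (99/800 * (real L)\<^sup>2) * (4/19 * (real n / real K))"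
    by simp
  also have "\<dots> \<le> row_gain 64 * (real (L div 4) * real (L - 2 * (L div 4)))
      * (real k * (real (N - K) / real N))"
  proof (rule mult_mono)
    show "24/25 * (99/800 * (real L)\<^sup>2)
        \<le> row_gain 64 * (real (L div 4) * real (L - 2 * (L div 4)))"
      using row_gain_64 quarter_split_quadratic[OF assms(1)] row_gain_nonneg[of 64]
      by (rule mult_mono) auto
    show "4/19 * (real n / real K) \<le> real k * (real (N - K) / real N)"
      using assms(2-5) by (rule n_div_K_le_block_count)
  qed (use row_gain_nonneg[of 64] in auto)
  finally show ?thesis by (simp add: mult.assoc)
qed

theorem theorem4p3:
  fixes M :: "'r measure" and A :: "'r stream_alg" and L n K s :: nat
  assumes "2 * K \<le> n"
    and "L + 1 \<le> K"
    and "real L \<ge> 12 * ln (4 * real n)"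
    and "streaming_algorithm M n s A"
    and "robust_coloring M n L K (1/4) A"
  shows "real s \<ge> 1 / (40 * ln 2) * (real n * (real L)\<^sup>2 / real K) - 3"
proof -
  have L: "L \<ge> 64" using assms(1-3) by (rule degree_bound_ge_64)
  obtain k N where kN: "k * N \<le> n" "n < k * (N + 1)" "N \<le> 3 * K" "3 * K < 2 * (N + 1)"
    using ex_block_count_and_size[of K n] assms(1,2) by auto
  define q d_greedy where "q = L div 4" and "d_greedy = L - 2 * q"
  have d: "2 * q + d_greedy = L" "2 * d_greedy \<le> L + 3" by (simp_all add: q_def d_greedy_def)
  have N: "N > 0" "d_greedy + 64 \<le> N" using d(2) kN(4) L assms(2) by presburger+
  obtain \<B> where \<B>: "finite \<B>" "card \<B> = k" "disjoint \<B>" "\<And>B. B \<in> \<B> \<Longrightarrow> B \<subseteq> {1..n} \<and> card B = N"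
    using ex_disjoint_subsets[of "{1..n}" N k] N(1) kN(1) by auto
  interpret coloring_game \<B> n K "2 * q" d_greedy
    using \<B> by unfold_locales (auto intro: finite_subset)
  have "avoidance_exponent 64 q + ln (1/4) \<le> s * ln 2"
    by (rule state_space_lower_bound[OF assms(4) assms(5)[folded d(1)]])
      (use assms(1,2) L N(2) \<B>(4) in \<open>auto simp: q_def\<close>)
  moreover have "avoidance_exponent 64 q = row_gain 64 * q * d_greedy * (k * (real (N - K) / N))"
    unfolding avoidance_exponent_def using \<B>(2,4) by simp
  moreover have "1/40 * (real n * (real L)\<^sup>2 / real K) \<le> \<dots>"
    unfolding d_greedy_def q_def using L assms(2) by (intro space_bound_le_exponent kN) auto
  moreover have "ln (1/4 :: real) = - 2 * ln 2" using ln_realpow[of 2 2] by (simp add: ln_div)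
  ultimately have "1/40 * (real n * (real L)\<^sup>2 / real K) \<le> (s + 2) * ln 2"
    by (simp add: algebra_simps)
  from divide_right_mono[OF this, of "ln 2"] show ?thesis by (simp add: mult_ac)
qed

end
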